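(* Let $B$ be an inner function with weak Property $\mathfrak{B}$. Then $B$ is a Blaschke product.
   Context: $\mathbb{D}$ is the open unit disk. An inner function is a bounded analytic function on $\mathbb{D}$ with unimodular radial limits almost everywhere on $\partial\mathbb{D}$. A Blaschke product is an inner function $B(z)=\lambda z^m\prod_n\frac{|\alpha_n|}{\alpha_n}\frac{\alpha_n-z}{1-\overline{\alpha_n}z}$ with $|\lambda|=1$, $m\ge0$ an integer, $\{\alpha_n\}$ a (possibly empty) finite or infinite sequence in $\mathbb{D}\setminus\{0\}$ with $\sum_n(1-|\alpha_n|)<\infty$. An inner function $u$ has weak Property $\mathfrak{B}$ if there exists $\theta\in(0,1)$ such that the closure of each connected component of $\{z\in\mathbb{D}:|u(z)|<\theta\}$ is contained in $\mathbb{D}$. *)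

theory Defs
  imports "HOL-Analysis.Analysis" "HOL-Library.Extended_Nat"
begin

(* Functions on the unit disc are total functions complex => complex; only their values on
   ball 0 1 matter. The unit circle is parametrised by cis t, so that "almost everywhere on
   the circle" is with respect to Lebesgue measure in t. *)

definition inner_function :: "(complex \<Rightarrow> complex) \<Rightarrow> bool" where
  "inner_function u \<longleftrightarrow>
     u analytic_on ball 0 1 \<and> bounded (u ` ball 0 1) \<and>
     (AE t in lebesgue_on {0..2 * pi}.
        \<exists>l. cmod l = 1 \<and> ((\<lambda>r. u (complex_of_real r * cis t)) \<longlongrightarrow> l) (at_left 1))"

definition blaschke_factor :: "complex \<Rightarrow> complex \<Rightarrow> complex" where
  "blaschke_factor a z = (complex_of_real (cmod a) / a) * ((a - z) / (1 - cnj a * z))"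

(* The sequence of zeros other than 0 is a n for n < N: N = 0 is the empty sequence, N finite
   a finite one, and N = \<infinity> an infinite one. Indices n \<ge> N contribute the factor 1. Note that
   has_prod permits finitely many vanishing factors, so the product is also meaningful at
   the zeros. *)

definition blaschke_product :: "(complex \<Rightarrow> complex) \<Rightarrow> bool" where
  "blaschke_product B \<longleftrightarrow>
     inner_function B \<and>
     (\<exists>(c::complex) (m::nat) (N::enat) (a :: nat \<Rightarrow> complex).
        cmod c = 1 \<and>
        (\<forall>n. enat n < N \<longrightarrow> a n \<in> ball 0 1 - {0}) \<and>
        summable (\<lambda>n. if enat n < N then 1 - cmod (a n) else 0) \<and>
        (\<forall>z\<in>ball 0 1. \<exists>p.
           (\<lambda>n. if enat n < N then blaschke_factor (a n) z else 1) has_prod p \<and>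
           B z = c * z ^ m * p))"

definition weak_property_B :: "(complex \<Rightarrow> complex) \<Rightarrow> bool" where
  "weak_property_B u \<longleftrightarrow>
     (\<exists>\<theta>::real. 0 < \<theta> \<and> \<theta> < 1 \<and>
        (\<forall>C\<in>components {z \<in> ball 0 1. cmod (u z) < \<theta>}. closure C \<subseteq> ball 0 1))"

end

(* Write B = b S with b the Blaschke product formed from the zeros of B, so that S is zero-free and
   |B| <= |S| <= 1. Off the sublevel set {|B| < theta} this gives |S| >= theta. A component C of the
   sublevel set is relatively compact in the disc and |S| >= |B| >= theta on its frontier, so the
   maximum principle for 1/S gives |S| >= theta on C as well. Hence 1/S is bounded, and it has radial
   limits of modulus 1 almost everywhere by squeezing |S| between |B| and 1; so |1/S| <= 1 and
   S is a unimodular constant.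

   The factorisation needs no bookkeeping of multiplicities: zeros of minimal modulus are divided out
   one at a time, and S is a locally uniform limit of a subsequence of the successive quotients. *)

theory Submission
  imports Defs "HOL-Complex_Analysis.Complex_Analysis"
begin

section \<open>Bounded functions whose radial limits have modulus 1\<close>

text \<open>Cauchy's formula on the circle of radius \<open>r\<close>, with the kernel bounded by
  1/(r - |z|) and the extra factor \<open>r\<close> by 1. The constant is cruder than the one from
  the Poisson kernel, but it does not depend on \<open>f\<close>, so the estimate can be applied to
  all powers of a function at once.\<close>

lemma cmod_le_circle_mean:
  fixes f :: "complex \<Rightarrow> complex"
  assumes f: "f holomorphic_on ball 0 1" and z: "cmod z < r" and r: "r < 1"
  shows "2 * pi * (r - cmod z) * cmod (f z) \<le>
           (LINT t|lebesgue_on {0..2 * pi}. cmod (f (complex_of_real r * cis t)))"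
proof -
  have r0: "0 < r"
    using z norm_ge_zero[of z] by linarith
  have cf: "continuous_on (ball 0 1) f"
    using f by (rule holomorphic_on_imp_continuous_on)
  have ft: "continuous_on {0..2 * pi} (\<lambda>t. f (complex_of_real r * cis t))"
    by (rule continuous_on_compose2[OF cf])
       (use r0 r in \<open>auto intro!: continuous_intros simp: norm_mult\<close>)
  have int: "integrable (lebesgue_on {0..2 * pi}) (\<lambda>t. cmod (f (complex_of_real r * cis t)))"
    by (rule continuous_imp_integrable_real) (intro continuous_intros ft)
  have eq: "(LINT t|lebesgue_on {0..2 * pi}. cmod (f (complex_of_real r * cis t))) =
            integral {0..2 * pi} (\<lambda>t. cmod (f (complex_of_real r * cis t)))"
    by (rule lebesgue_integral_eq_integral[OF int]) simp
  have "((\<lambda>u. f u / (u - z)) has_contour_integral (2 * of_real pi * \<i> * f z)) (circlepath 0 r)"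
    by (rule Cauchy_integral_circlepath_simple)
       (use r z in \<open>auto intro!: holomorphic_on_subset[OF f]\<close>)
  hence hi: "((\<lambda>t. f (r * cis t) / (r * cis t - z) * r * \<i> * cis t) has_integral
           (2 * of_real pi * \<i> * f z)) {0..2 * pi}"
    unfolding circlepath_def by (subst (asm) has_contour_integral_part_circlepath_iff) auto
  have "norm (integral {0..2 * pi} (\<lambda>t. f (r * cis t) / (r * cis t - z) * r * \<i> * cis t)) \<le>
          integral {0..2 * pi} (\<lambda>t. cmod (f (complex_of_real r * cis t)) * (1 / (r - cmod z)))"
  proof (rule integral_norm_bound_integral)
    show "(\<lambda>t. f (r * cis t) / (r * cis t - z) * r * \<i> * cis t) integrable_on {0..2 * pi}"
      using hi by blast
    show "(\<lambda>t. cmod (f (complex_of_real r * cis t)) * (1 / (r - cmod z))) integrable_on {0..2 * pi}"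
      by (intro integrable_continuous_real continuous_intros ft)
    fix t :: real
    have "r - cmod z \<le> cmod (r * cis t - z)"
      using norm_triangle_ineq2[of "r * cis t" z] r0 by (simp add: norm_mult)
    moreover have "0 < r - cmod z" using z by simp
    ultimately have "cmod (f (r * cis t)) * r / cmod (r * cis t - z) \<le> cmod (f (r * cis t)) * 1 / (r - cmod z)"
      using r0 r by (intro frac_le mult_left_mono mult_nonneg_nonneg) auto
    thus "norm (f (r * cis t) / (r * cis t - z) * r * \<i> * cis t) \<le>
          cmod (f (complex_of_real r * cis t)) * (1 / (r - cmod z))"
      using r0 by (simp add: norm_mult norm_divide mult_ac)
  qed
  hence "2 * pi * cmod (f z) \<le> (1 / (r - cmod z)) * integral {0..2 * pi} (\<lambda>t. cmod (f (complex_of_real r * cis t)))"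
    using integral_unique[OF hi] by (simp add: norm_mult)
  thus ?thesis
    using z unfolding eq by (simp add: field_simps)
qed

lemma power_le_imp_le_1:
  fixes x C :: real
  assumes "0 \<le> x" and "\<And>n. x ^ n \<le> C"
  shows "x \<le> 1"
proof (rule ccontr)
  assume "\<not> x \<le> 1"
  then obtain n where "C < x ^ n"
    using real_arch_pow[of x C] by auto
  with assms(2)[of n] show False by simp
qed

text \<open>As the circles grow to radius 1, the means of |f|^k tend to 1 for every
  \<open>k\<close>, with \<open>M ^ k\<close> as dominating function. Hence (1 - |z|) |f z|^k stays
  below 1 for all \<open>k\<close>. The result serves twice: for \<open>B\<close> itself and for
  1/S.\<close>

lemma cmod_le_1_if_radial_limits_1:
  fixes f :: "complex \<Rightarrow> complex"
  assumes f: "f holomorphic_on ball 0 1" and bdd: "\<And>z. z \<in> ball 0 1 \<Longrightarrow> cmod (f z) \<le> M"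
    and lim: "AE t in lebesgue_on {0..2 * pi}.
                ((\<lambda>r. cmod (f (complex_of_real r * cis t))) \<longlongrightarrow> 1) (at_left 1)"
    and z: "z \<in> ball 0 1"
  shows "cmod (f z) \<le> 1"
proof -
  let ?L = "lebesgue_on {0..2 * pi}"
  have cf: "continuous_on (ball 0 1) f"
    using f by (rule holomorphic_on_imp_continuous_on)
  \<comment> \<open>Dominated convergence is applied along a sequence of radii; the shift by 2 keeps
    \<open>s 0\<close> strictly between 0 and 1.\<close>
  define s where "s n = 1 - 1 / (real n + 2)" for n
  have s: "0 < s n" "s n < 1" for n
    by (auto simp: s_def field_simps)
  have s_lim: "s \<longlonglongrightarrow> 1"
    unfolding s_def by real_asymp
  have s_left: "filterlim s (at_left 1) sequentially"
    unfolding filterlim_at using s_lim s by (simp add: order.strict_implies_not_eq)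
  \<comment> \<open>A bound on all powers of \<open>f\<close> upgrades the crude Cauchy estimate to the sharp one.\<close>
  show ?thesis
  proof (rule power_le_imp_le_1)
    fix k :: nat
    have "(\<lambda>n. LINT t|?L. cmod (f (complex_of_real (s n) * cis t)) ^ k) \<longlonglongrightarrow> (LINT t|?L. 1)"
    proof (rule integral_dominated_convergence[where w = "\<lambda>_. M ^ k"])
      show "(\<lambda>t. cmod (f (complex_of_real (s n) * cis t)) ^ k) \<in> borel_measurable ?L" for n
        by (intro continuous_imp_measurable_on_sets_lebesgue continuous_intros
              continuous_on_compose2[OF cf])
           (use s[of n] in \<open>auto simp: norm_mult\<close>)
      show "AE t in ?L. (\<lambda>n. cmod (f (complex_of_real (s n) * cis t)) ^ k) \<longlonglongrightarrow> 1"
        using lim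
      proof eventually_elim
        case (elim t)
        from tendsto_power[OF filterlim_compose[OF elim s_left], of k] show ?case by simp
      qed
      show "AE t in ?L. norm (cmod (f (complex_of_real (s n) * cis t)) ^ k) \<le> M ^ k" for n
        using s[of n] by (intro AE_I2) (auto intro!: power_mono bdd simp: norm_mult)
    qed auto
    moreover have "(\<lambda>n. 2 * pi * (s n - cmod z) * cmod (f z) ^ k) \<longlonglongrightarrow> 2 * pi * (1 - cmod z) * cmod (f z) ^ k"
      by (intro tendsto_intros s_lim)
    moreover have "\<forall>\<^sub>F n in sequentially. 2 * pi * (s n - cmod z) * cmod (f z) ^ k \<le>
        (LINT t|?L. cmod (f (complex_of_real (s n) * cis t)) ^ k)"
    proof -
      have "\<forall>\<^sub>F n in sequentially. cmod z < s n"
        using z by (intro order_tendstoD(1)[OF s_lim]) auto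
      thus ?thesis
      proof eventually_elim
        case (elim n)
        have "(\<lambda>w. f w ^ k) holomorphic_on ball 0 1"
          by (intro holomorphic_intros f)
        from cmod_le_circle_mean[OF this elim s(2)] show ?case by (simp add: norm_power)
      qed
    qed
    ultimately have "2 * pi * (1 - cmod z) * cmod (f z) ^ k \<le> (LINT t|?L. 1)"
      by (intro tendsto_le[OF sequentially_bot])
    also have "\<dots> = 2 * pi"
      by (simp add: measure_restrict_space)
    finally have "2 * pi * ((1 - cmod z) * cmod (f z) ^ k) \<le> 2 * pi * 1"
      by (simp only: mult.assoc mult_1_right)
    hence "(1 - cmod z) * cmod (f z) ^ k \<le> 1"
      by (subst (asm) mult_le_cancel_left_pos) auto
    thus "cmod (f z) ^ k \<le> 1 / (1 - cmod z)"
      using z by (simp add: field_simps)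
  qed simp
qed

section \<open>Blaschke factors and division by zeros\<close>

text \<open>The difference equals -(1 - |a|)(a + |a|z) / (a(1 - cnj a z)). The numerator carries a
  hidden factor |a|, since |a + |a|z| is at most 2|a|, so small \<open>a\<close> does no harm. This
  compares the product with the sum of the 1 - |a|.\<close>

lemma blaschke_factor_minus_one:
  assumes a: "a \<in> ball 0 1 - {0}" and z: "z \<in> ball 0 1"
  shows "cmod (blaschke_factor a z - 1) \<le> 2 / (1 - cmod z) * (1 - cmod a)"
proof -
  have az: "cmod (cnj a * z) \<le> cmod z"
    using a by (simp add: norm_mult mult_left_le_one_le)
  hence nz: "1 - cnj a * z \<noteq> 0"
    using z by auto
  have aa: "a * cnj a = (cmod a)^2"
    by (metis complex_norm_square of_real_power)
  have n1: "cmod (1 - complex_of_real (cmod a)) = 1 - cmod a"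
    using a norm_of_real[of "1 - cmod a", where ?'a = complex] by simp
  have "blaschke_factor a z - 1 = (complex_of_real (cmod a) * (a - z) - a * (1 - cnj a * z)) / (a * (1 - cnj a * z))"
    using nz a unfolding blaschke_factor_def by (simp add: field_simps)
  also have "complex_of_real (cmod a) * (a - z) - a * (1 - cnj a * z) =
      complex_of_real (cmod a) * (a - z) - a + (a * cnj a) * z"
    by (simp add: algebra_simps)
  also have "\<dots> = - (1 - cmod a) * (a + cmod a * z)"
    unfolding aa by (simp add: algebra_simps power2_eq_square)
  finally have "cmod (blaschke_factor a z - 1) =
      (1 - cmod a) * cmod (a + cmod a * z) / (cmod a * cmod (1 - cnj a * z))"
    using a n1 by (simp add: norm_divide norm_mult norm_minus_commute[of _ 1])
  also have "\<dots> \<le> (1 - cmod a) * (2 * cmod a) / (cmod a * (1 - cmod z))"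
  proof (intro frac_le mult_left_mono mult_nonneg_nonneg)
    have "cmod (a + cmod a * z) \<le> cmod a + cmod a * cmod z"
      using norm_triangle_ineq[of a "cmod a * z"] by (simp add: norm_mult)
    also have "\<dots> \<le> 2 * cmod a"
      using z by (simp add: mult_left_le)
    finally show "cmod (a + cmod a * z) \<le> 2 * cmod a" .
    show "1 - cmod z \<le> cmod (1 - cnj a * z)"
      using norm_triangle_ineq2[of 1 "cnj a * z"] az by simp
  qed (use a z in auto)
  also have "\<dots> = 2 / (1 - cmod z) * (1 - cmod a)"
    using a by simp
  finally show ?thesis .
qed

text \<open>This is the Schwarz-Pick argument: composing \<open>f\<close> with the disc automorphism
  that sends 0 to \<open>a\<close> gives a function vanishing at 0, and the Schwarz lemma bounds |f|
  by the modulus of the factor to be divided out. The bound 1 thus survives the division, which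
  makes the step repeatable.\<close>

lemma divide_out_zero:
  assumes f: "f holomorphic_on ball 0 1" and le1: "\<And>z. z \<in> ball 0 1 \<Longrightarrow> cmod (f z) \<le> 1"
    and a: "a \<in> ball 0 1" and fa: "f a = 0"
  obtains h where "h holomorphic_on ball 0 1"
    and "\<And>z. z \<in> ball 0 1 \<Longrightarrow> cmod (h z) \<le> 1"
    and "\<And>z. z \<in> ball 0 1 \<Longrightarrow> f z = (a - z) / (1 - cnj a * z) * h z"
proof -
  have nz: "1 - cnj a * z \<noteq> 0" if "z \<in> ball 0 1" for z
  proof -
    have "cmod (cnj a * z) < 1"
      using a that norm_mult_less[of "cnj a" 1 z 1] by simp
    thus ?thesis by auto
  qed
  have schwarz: "cmod (f z) \<le> cmod (Moebius_function 0 a z)" if z: "z \<in> ball 0 1" for z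
  proof (rule field_le_mult_one_interval)
    fix c :: real
    assume c: "0 < c" "c < 1"
    \<comment> \<open>The factor \<open>c\<close> provides the strict bound that the Schwarz lemma requires.\<close>
    let ?F = "\<lambda>w. complex_of_real c * f (Moebius_function 0 (- a) w)"
    have lt1: "Moebius_function 0 (- a) w \<in> ball 0 1" if "cmod w < 1" for w
      using that a by (auto intro!: Moebius_function_norm_lt_1)
    have "cmod (?F (Moebius_function 0 a z)) \<le> cmod (Moebius_function 0 a z)"
    proof (rule Schwarz_Lemma(1))
      have "(f \<circ> Moebius_function 0 (- a)) holomorphic_on ball 0 1"
        by (intro holomorphic_on_compose_gen[OF _ f] Moebius_function_holomorphic)
           (use a lt1 in auto)
      thus "?F holomorphic_on ball 0 1"
        by (intro holomorphic_intros) (simp_all add: o_def)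
      show "?F 0 = 0"
        by (simp add: Moebius_function_of_zero fa)
      fix w :: complex
      assume "cmod w < 1"
      hence "c * cmod (f (Moebius_function 0 (- a) w)) \<le> c * 1"
        using c by (intro mult_left_mono le1 lt1) auto
      also have "\<dots> < 1"
        using c by simp
      finally show "cmod (?F w) < 1"
        using c by (simp add: norm_mult)
    qed (use a z in \<open>auto intro!: Moebius_function_norm_lt_1\<close>)
    moreover have "Moebius_function 0 (- a) (Moebius_function 0 a z) = z"
      using a z by (intro Moebius_function_compose) auto
    ultimately show "c * cmod (f z) \<le> cmod (Moebius_function 0 a z)"
      using c by (simp add: norm_mult)
  qed
  \<comment> \<open>The difference quotient, filled in by the derivative, is holomorphic across
    \<open>a\<close>. The minus sign in \<open>h\<close> turns z - a into a - z.\<close>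
  define q where "q z = (if z = a then deriv f a else (f z - f a) / (z - a))" for z
  define h where "h z = - q z * (1 - cnj a * z)" for z
  have holq: "q holomorphic_on ball 0 1"
    unfolding q_def by (intro pole_lemma_open f) auto
  have holh: "h holomorphic_on ball 0 1"
    unfolding h_def by (intro holomorphic_intros holq)
  have eq: "f z = (a - z) / (1 - cnj a * z) * h z" if "z \<in> ball 0 1" for z
  proof (cases "z = a")
    case False
    hence "h z = f z / (a - z) * (1 - cnj a * z)"
      by (simp add: h_def q_def fa minus_divide_right)
    with False nz[OF that] show ?thesis by simp
  qed (simp add: fa)
  have le: "cmod (h z) \<le> 1" if z: "z \<in> ball 0 1" and "z \<noteq> a" for z
  proof -
    let ?M = "Moebius_function 0 a z"
    have "cmod (f z) = cmod ?M * cmod (h z)"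
      using eq[OF z] by (simp add: Moebius_function_simple norm_mult norm_divide norm_minus_commute)
    moreover have "cmod ?M > 0"
      using \<open>z \<noteq> a\<close> nz[OF z] by (simp add: Moebius_function_simple)
    ultimately show ?thesis
      using schwarz[OF z] by simp
  qed
  \<comment> \<open>At \<open>a\<close> both sides of the factorisation vanish, so the bound has to
    come from nearby points by continuity.\<close>
  have "cmod (h a) \<le> 1"
  proof (rule tendsto_upperbound)
    show "((\<lambda>z. cmod (h z)) \<longlongrightarrow> cmod (h a)) (at a)"
      using holomorphic_on_imp_continuous_on[OF holh] a
      by (intro tendsto_norm) (simp add: continuous_on_eq_continuous_at isCont_def)
    have "\<forall>\<^sub>F z in at a. z \<in> ball 0 1 - {a}"
      by (rule eventually_at_in_open[OF open_ball a])
    thus "\<forall>\<^sub>F z in at a. cmod (h z) \<le> 1"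
      by eventually_elim (use le in blast)
  qed simp
  with le have "cmod (h z) \<le> 1" if "z \<in> ball 0 1" for z
    using that by blast
  from holh this eq show thesis
    by (rule that)
qed

lemma cmod_blaschke_factor_le_1:
  assumes "a \<in> ball 0 1" and "z \<in> ball 0 1"
  shows "cmod (blaschke_factor a z) \<le> 1"
proof -
  \<comment> \<open>This is an inequality because at \<open>a = 0\<close> division by zero makes the
    prefactor |a|/a equal to 0; otherwise it is unimodular.\<close>
  have "cmod (blaschke_factor a z) \<le> cmod (Moebius_function 0 a z)"
    by (simp add: blaschke_factor_def Moebius_function_simple norm_mult norm_divide
          norm_minus_commute[of a z] mult_left_le_one_le)
  also have "\<dots> \<le> 1"
    using assms Moebius_function_norm_lt_1[of a z 0] by simp
  finally show ?thesis .
qed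

text \<open>The zeros in the closed disc of radius |w| form a nonempty compact set, so one of them
  has least modulus, and any zero outside that disc is larger still. The unimodular constant by
  which the Blaschke factor differs from the plain quotient is moved into \<open>h\<close>.\<close>

lemma divide_out_minimal_zero:
  assumes f: "f holomorphic_on ball 0 1" and le1: "\<And>z. z \<in> ball 0 1 \<Longrightarrow> cmod (f z) \<le> 1"
    and f0: "f 0 \<noteq> 0" and w: "w \<in> ball 0 1" "f w = 0"
  obtains a h where "a \<in> ball 0 1 - {0}"
    and "\<And>z. z \<in> ball 0 1 \<Longrightarrow> f z = 0 \<Longrightarrow> cmod a \<le> cmod z"
    and "h holomorphic_on ball 0 1"
    and "\<And>z. z \<in> ball 0 1 \<Longrightarrow> cmod (h z) \<le> 1"
    and "\<And>z. z \<in> ball 0 1 \<Longrightarrow> f z = blaschke_factor a z * h z"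
proof -
  have cont: "continuous_on (cball 0 (cmod w)) f"
    using w by (intro continuous_on_subset[OF holomorphic_on_imp_continuous_on[OF f]]) auto
  have "closed {z \<in> cball 0 (cmod w). f z = 0}"
    using continuous_closed_preimage_constant[OF cont closed_cball, of 0] by simp
  hence "compact {z \<in> cball 0 (cmod w). f z = 0}"
    unfolding compact_eq_bounded_closed
    by (intro conjI bounded_subset[OF bounded_cball[of 0 "cmod w"]]) blast
  moreover have "{z \<in> cball 0 (cmod w). f z = 0} \<noteq> {}"
    using w by auto
  ultimately have "\<exists>a\<in>{z \<in> cball 0 (cmod w). f z = 0}. \<forall>z\<in>{z \<in> cball 0 (cmod w). f z = 0}. cmod a \<le> cmod z"
    by (intro continuous_attains_inf continuous_intros)
  then obtain a where a: "a \<in> {z \<in> cball 0 (cmod w). f z = 0}"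
    and min: "\<And>z. z \<in> {z \<in> cball 0 (cmod w). f z = 0} \<Longrightarrow> cmod a \<le> cmod z"
    by blast
  have ab: "a \<in> ball 0 1" "f a = 0"
    using a w by auto
  with f0 have a0: "a \<noteq> 0" by auto
  obtain h where h: "h holomorphic_on ball 0 1" "\<And>z. z \<in> ball 0 1 \<Longrightarrow> cmod (h z) \<le> 1"
    and eq: "\<And>z. z \<in> ball 0 1 \<Longrightarrow> f z = (a - z) / (1 - cnj a * z) * h z"
    by (rule divide_out_zero[OF f le1 ab]) auto
  let ?c = "a / complex_of_real (cmod a)"
  show thesis
  proof (rule that[of a "\<lambda>z. ?c * h z"])
    show "cmod a \<le> cmod z" if "z \<in> ball 0 1" "f z = 0" for z
      using min[of z] min[of w] w that by (cases "cmod z \<le> cmod w") auto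
    show "(\<lambda>z. ?c * h z) holomorphic_on ball 0 1"
      by (intro holomorphic_intros h) (use a0 in auto)
    show "f z = blaschke_factor a z * (?c * h z)" if "z \<in> ball 0 1" for z
      using eq[OF that] a0 by (simp add: blaschke_factor_def)
  qed (use ab a0 h(2) in \<open>auto simp: norm_mult norm_divide\<close>)
qed

section \<open>Factorisation into a power of z, a Blaschke product and a zero-free function\<close>

text \<open>Since minimal zeros are removed first, every zero of the n-th quotient is at least as
  large as \<open>a n\<close>. Summability forces |a_n| to 1 if there are infinitely many, so the
  zeros of the quotients leave every smaller disc, and by Hurwitz's theorem the limit has
  none.\<close>

lemma split_off_blaschke_product:
  assumes f: "f holomorphic_on ball 0 1" and le1: "\<And>z. z \<in> ball 0 1 \<Longrightarrow> cmod (f z) \<le> 1"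
    and f0: "f 0 \<noteq> 0"
  obtains N :: enat and a :: "nat \<Rightarrow> complex" and S :: "complex \<Rightarrow> complex"
  where "\<And>n. enat n < N \<Longrightarrow> a n \<in> ball 0 1 - {0}"
    and "summable (\<lambda>n. if enat n < N then 1 - cmod (a n) else 0)"
    and "S holomorphic_on ball 0 1"
    and "\<And>z. z \<in> ball 0 1 \<Longrightarrow> S z \<noteq> 0"
    and "\<And>z. z \<in> ball 0 1 \<Longrightarrow> cmod (f z) \<le> cmod (S z)"
    and "\<And>z. z \<in> ball 0 1 \<Longrightarrow> cmod (S z) \<le> 1"
    and "\<And>z. z \<in> ball 0 1 \<Longrightarrow>
           \<exists>p. (\<lambda>n. if enat n < N then blaschke_factor (a n) z else 1) has_prod p \<and> f z = p * S z"
proof -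
  define D :: "complex set" where "D = ball 0 1"
  have D0: "0 \<in> D" and oD: "open D"
    by (auto simp: D_def)
  define Z where "Z g \<longleftrightarrow> (\<exists>z\<in>D. g z = 0)" for g :: "complex \<Rightarrow> complex"
  \<comment> \<open>Once no zero is left the quotient is repeated and \<open>a\<close> is arbitrary;
    hence the guards \<open>enat n < N\<close> below.\<close>
  define R where "R g h a \<longleftrightarrow>
      (if Z g then a \<in> D - {0} \<and> (\<forall>z\<in>D. g z = 0 \<longrightarrow> cmod a \<le> cmod z) \<and>
                   (\<forall>z\<in>D. g z = blaschke_factor a z * h z)
       else h = g)" for g h :: "complex \<Rightarrow> complex" and a
  define P where "P g \<longleftrightarrow> g holomorphic_on D \<and> (\<forall>z\<in>D. cmod (g z) \<le> 1) \<and> g 0 \<noteq> 0" for g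
  \<comment> \<open>The quotients alone are chosen recursively, with the conjunct for
    \<open>n = 0\<close> fixing the start; the zeros are picked afterwards from the
    existential.\<close>
  have "\<exists>G. \<forall>n. (P (G n) \<and> (n = 0 \<longrightarrow> G n = f)) \<and> (\<exists>a. R (G n) (G (Suc n)) a)"
  proof (rule dependent_nat_choice)
    show "\<exists>g. P g \<and> (0 = (0::nat) \<longrightarrow> g = f)"
      using f le1 f0 by (auto simp: P_def D_def)
    fix g and n :: nat
    assume "P g \<and> (n = 0 \<longrightarrow> g = f)"
    hence g: "P g" by simp
    show "\<exists>h. (P h \<and> (Suc n = 0 \<longrightarrow> h = f)) \<and> (\<exists>a. R g h a)"
    proof (cases "Z g")
      case True
      then obtain w where w: "w \<in> ball 0 1" "g w = 0"
        by (auto simp: Z_def D_def)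
      from g have g': "g holomorphic_on ball 0 1" "\<And>z. z \<in> ball 0 1 \<Longrightarrow> cmod (g z) \<le> 1" "g 0 \<noteq> 0"
        by (auto simp: P_def D_def)
      obtain a h where ah: "a \<in> ball 0 1 - {0}"
        "\<And>z. z \<in> ball 0 1 \<Longrightarrow> g z = 0 \<Longrightarrow> cmod a \<le> cmod z"
        "h holomorphic_on ball 0 1" "\<And>z. z \<in> ball 0 1 \<Longrightarrow> cmod (h z) \<le> 1"
        "\<And>z. z \<in> ball 0 1 \<Longrightarrow> g z = blaschke_factor a z * h z"
        using divide_out_minimal_zero[OF g' w] by metis
      from ah(5)[of 0] g'(3) have "h 0 \<noteq> 0"
        by auto
      with ah True have "P h" "R g h a"
        by (auto simp: P_def R_def D_def)
      thus ?thesis by auto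
    qed (use g in \<open>auto simp: R_def\<close>)
  qed
  then obtain G a where PG: "P (G n)" and G0: "G 0 = f" and RG: "R (G n) (G (Suc n)) (a n)" for n
    by metis
  have holG: "G n holomorphic_on D" and leG: "z \<in> D \<Longrightarrow> cmod (G n z) \<le> 1" for n z
    using PG[of n] by (auto simp: P_def)

  \<comment> \<open>Zero-freeness persists from one quotient to the next, so the indices below
    \<open>N\<close> are exactly those at which a zero is divided out.\<close>
  define N where "N = (if \<exists>n. \<not> Z (G n) then enat (LEAST n. \<not> Z (G n)) else \<infinity>)"
  have Z_mono: "\<not> Z (G m)" if "\<not> Z (G n)" "n \<le> m" for n m
    using that(2) by (induction rule: dec_induct) (use that(1) RG in \<open>auto simp: R_def\<close>)
  have N_iff: "enat n < N \<longleftrightarrow> Z (G n)" for n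
  proof (cases "\<exists>n. \<not> Z (G n)")
    case True
    define k where "k = (LEAST n. \<not> Z (G n))"
    have "\<not> Z (G k)" and "\<And>n. n < k \<Longrightarrow> Z (G n)"
      unfolding k_def using LeastI_ex[OF True] not_less_Least by blast+
    hence "n < k \<longleftrightarrow> Z (G n)"
      using Z_mono[of k n] by (cases "n < k") auto
    with True show ?thesis by (simp add: N_def k_def)
  qed (simp add: N_def)
  define F where "F z n = (if enat n < N then blaschke_factor (a n) z else 1)" for z n
  define d where "d n = (if enat n < N then 1 - cmod (a n) else 0)" for n
  have aD: "a n \<in> ball 0 1 - {0}" if "enat n < N" for n
    using RG[of n] that by (auto simp: R_def N_iff D_def)
  have G_Suc: "G n z = F z n * G (Suc n) z" if "z \<in> D" for n z
    using RG[of n] that by (auto simp: R_def F_def N_iff)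
  have F_le: "cmod (F z n) \<le> 1" if "z \<in> D" for z n
    using cmod_blaschke_factor_le_1[of "a n" z] aD[of n] that by (auto simp: F_def D_def)
  have f_eq: "f z = (\<Prod>k<n. F z k) * G n z" if "z \<in> D" for n z
  proof (induction n)
    case (Suc n)
    show ?case
      unfolding Suc.IH G_Suc[OF that, of n] by (simp add: mult.assoc)
  qed (simp add: G0)
  have G_ge: "cmod (f z) \<le> cmod (G n z)" if "z \<in> D" for n z
  proof -
    have "cmod (\<Prod>k<n. F z k) \<le> 1"
      unfolding prod_norm[symmetric] by (rule prod_le_1) (use F_le[OF that] in auto)
    thus ?thesis
      unfolding f_eq[OF that, of n] by (simp add: norm_mult mult_left_le_one_le)
  qed
  have d_nonneg: "d n \<ge> 0" for n
    using aD[of n] by (auto simp: d_def)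

  \<comment> \<open>A Blaschke factor has the value |a_k| = 1 - d_k at 0, and |G_n(0)| is at most 1.
    So |f(0)| is at most the product of the 1 - d_k, hence at most exp of minus their sum, and f(0)
    being nonzero bounds the partial sums.\<close>
  have summ: "summable d"
  proof (rule summableI_nonneg_bounded)
    fix n
    have "cmod (f 0) \<le> cmod (\<Prod>k<n. F 0 k)"
      unfolding f_eq[OF D0, of n] using leG[OF D0, of n] by (simp add: norm_mult mult_left_le)
    also have "\<dots> = (\<Prod>k<n. 1 - d k)"
      unfolding prod_norm[symmetric]
      by (rule prod.cong) (use aD in \<open>auto simp: F_def d_def blaschke_factor_def norm_divide\<close>)
    also have "\<dots> \<le> (\<Prod>k<n. exp (- d k))"
      by (rule prod_mono) (use exp_ge_add_one_self[of "- d k" for k] in \<open>auto simp: d_def\<close>)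
    also have "\<dots> = exp (- (\<Sum>k<n. d k))"
      unfolding sum_negf[symmetric] by (subst exp_sum) auto
    finally have "ln (cmod (f 0)) \<le> ln (exp (- (\<Sum>k<n. d k)))"
      using f0 by (intro ln_mono) auto
    thus "(\<Sum>k<n. d k) \<le> - ln (cmod (f 0))"
      by simp
  qed (fact d_nonneg)

  have prod: "F z has_prod prodinf (F z)" if z: "z \<in> D" for z
  proof -
    have "summable (\<lambda>n. norm (F z n - 1))"
    proof (rule summable_comparison_test')
      show "summable (\<lambda>n. 2 / (1 - cmod z) * d n)"
        by (intro summable_mult summ)
      show "norm (norm (F z n - 1)) \<le> 2 / (1 - cmod z) * d n" for n
        using blaschke_factor_minus_one[OF aD[of n], of z] z
        by (auto simp: F_def d_def D_def)
    qed
    hence "convergent_prod (F z)"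
      by (intro abs_convergent_prod_imp_convergent_prod summable_imp_abs_convergent_prod)
    thus ?thesis
      by (rule convergent_prod_has_prod)
  qed

  \<comment> \<open>Montel's theorem applies because all quotients are bounded by 1. The partial
    products converge as a whole, so they can be followed along the same subsequence.\<close>
  obtain S r where S: "S holomorphic_on D" and r: "strict_mono (r :: nat \<Rightarrow> nat)"
    and lim: "\<And>x. x \<in> D \<Longrightarrow> (\<lambda>n. G (r n) x) \<longlonglongrightarrow> S x"
    and ul: "\<And>K. compact K \<Longrightarrow> K \<subseteq> D \<Longrightarrow> uniform_limit K (G \<circ> r) S sequentially"
  proof (rule Montel[of D "range G" G])
    show "\<exists>B. \<forall>h\<in>range G. \<forall>z\<in>K. norm (h z) \<le> B" if "compact K" "K \<subseteq> D" for K
      using that leG by (intro exI[of _ 1]) auto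
  qed (use oD holG in auto)
  have S_le: "cmod (S z) \<le> 1" and S_ge: "cmod (f z) \<le> cmod (S z)" if "z \<in> D" for z
    using that leG G_ge
    by (auto intro: tendsto_upperbound[OF tendsto_norm[OF lim[OF that]]]
          tendsto_lowerbound[OF tendsto_norm[OF lim[OF that]]])
  have S0: "S 0 \<noteq> 0"
    using S_ge[OF D0] f0 by auto
  have S_nz: "S z \<noteq> 0" if z: "z \<in> D" for z
  proof -
    obtain \<rho> where \<rho>: "cmod z < \<rho>" "\<rho> < 1"
      using z dense[of "cmod z" 1] by (auto simp: D_def)
    have \<rho>0: "0 < \<rho>"
      using \<rho> norm_ge_zero[of z] by linarith
    \<comment> \<open>For n below \<open>N\<close> this says |a_n| > \<rho>, so by minimality the
      n-th quotient has no zero in the disc of radius \<rho>; from \<open>N\<close> on it has no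
      zero at all.\<close>
    have "\<forall>\<^sub>F n in sequentially. d n < 1 - \<rho>"
      using summable_LIMSEQ_zero[OF summ] \<rho> by (intro order_tendstoD) auto
    then obtain M where M: "d n < 1 - \<rho>" if "n \<ge> M" for n
      by (auto simp: eventually_sequentially)
    have nz: "G n w \<noteq> 0" if "n \<ge> M" and w: "w \<in> ball 0 \<rho>" for n w
    proof
      assume "G n w = 0"
      moreover have wD: "w \<in> D"
        using w \<rho> by (auto simp: D_def)
      ultimately have "Z (G n)"
        by (auto simp: Z_def)
      moreover from this have "cmod (a n) \<le> cmod w"
        using RG[of n] wD \<open>G n w = 0\<close> by (auto simp: R_def)
      ultimately show False
        using M[OF \<open>n \<ge> M\<close>] w by (auto simp: d_def N_iff)
    qed
    have sub: "ball 0 \<rho> \<subseteq> D"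
      using \<rho> by (auto simp: D_def)
    show ?thesis
    \<comment> \<open>Hurwitz's theorem excludes constant limits; a constant is settled by its value
      at 0, which is nonzero as |S(0)| is at least |f(0)|.\<close>
    proof (cases "S constant_on ball 0 \<rho>")
      case True
      hence "S z = S 0"
        using \<rho> \<rho>0 by (auto simp: constant_on_def)
      with S0 show ?thesis by simp
    next
      case False
      show ?thesis
      \<comment> \<open>The shift by \<open>M\<close> discards the early quotients: \<open>r\<close>
        is strictly increasing, so r(n + M) is at least \<open>M\<close>.\<close>
      proof (rule Hurwitz_no_zeros[where S = "ball 0 \<rho>" and \<F> = "\<lambda>n. G (r (n + M))" and g = S])
        show "G (r (n + M)) holomorphic_on ball 0 \<rho>" for n
          using holG sub by (rule holomorphic_on_subset)
        show "S holomorphic_on ball 0 \<rho>"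
          using S sub by (rule holomorphic_on_subset)
        show "uniform_limit K (\<lambda>n. G (r (n + M))) S sequentially" if "compact K" "K \<subseteq> ball 0 \<rho>" for K
        proof -
          have "uniform_limit K (\<lambda>n. G (r n)) S sequentially"
            using ul[of K] that sub by (auto simp: o_def)
          thus ?thesis
            by (rule filterlim_compose[OF _ filterlim_add_const_nat_at_top])
        qed
        show "G (r (n + M)) w \<noteq> 0" if "w \<in> ball 0 \<rho>" for n w
          using nz[of "r (n + M)" w] that seq_suble[OF r, of "n + M"] by simp
      qed (use False \<rho> in auto)
    qed
  qed
  have eq: "f z = prodinf (F z) * S z" if z: "z \<in> D" for z
  proof (rule LIMSEQ_unique)
    have "(\<lambda>n. \<Prod>k<n. F z k) \<longlonglongrightarrow> prodinf (F z)"
      using convergent_prod_LIMSEQ[of "F z"] prod[OF z]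
      by (simp add: has_prod_iff LIMSEQ_lessThan_iff_atMost)
    hence "(\<lambda>n. \<Prod>k<r n. F z k) \<longlonglongrightarrow> prodinf (F z)"
      using LIMSEQ_subseq_LIMSEQ[OF _ r] by (auto simp: o_def)
    from tendsto_mult[OF this lim[OF z]] show "(\<lambda>n. f z) \<longlonglongrightarrow> prodinf (F z) * S z"
      using f_eq[OF z] by simp
  qed simp
  show thesis
  proof (rule that[of N a S])
    show "\<exists>p. (\<lambda>n. if enat n < N then blaschke_factor (a n) z else 1) has_prod p \<and> f z = p * S z"
      if "z \<in> ball 0 1" for z
      using prod[of z] eq[of z] that unfolding F_def D_def by blast
  qed (use aD summ S S_nz S_ge S_le in \<open>auto simp: D_def d_def[abs_def]\<close>)
qed

text \<open>If every quotient by a power of z vanished at 0, division could go on forever with bound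
  1, giving |f(w)| at most |w|^m for all \<open>m\<close> and so f(w) = 0.\<close>

lemma factor_out_power:
  assumes f: "f holomorphic_on ball 0 1" and le1: "\<And>z. z \<in> ball 0 1 \<Longrightarrow> cmod (f z) \<le> 1"
    and w: "w \<in> ball 0 1" "f w \<noteq> 0"
  obtains m g where "g holomorphic_on ball 0 1" and "\<And>z. z \<in> ball 0 1 \<Longrightarrow> cmod (g z) \<le> 1"
    and "g 0 \<noteq> 0" and "\<And>z. z \<in> ball 0 1 \<Longrightarrow> f z = z ^ m * g z"
proof -
  define P where "P m g \<longleftrightarrow> g holomorphic_on ball 0 1 \<and> (\<forall>z\<in>ball 0 1. cmod (g z) \<le> 1) \<and>
      (\<forall>z\<in>ball 0 1. f z = z ^ m * g z)" for m g
  have "\<exists>m g. P m g \<and> g 0 \<noteq> 0"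
  proof (rule ccontr)
    assume contr: "\<not> ?thesis"
    have ex: "\<exists>g. P m g" for m
    proof (induction m)
      case 0
      show ?case
        using f le1 by (auto simp: P_def)
    next
      case (Suc m)
      then obtain g where g: "P m g" by blast
      with contr have g0: "g 0 = 0" by blast
      obtain h where h: "h holomorphic_on ball 0 1" "\<And>z. z \<in> ball 0 1 \<Longrightarrow> cmod (h z) \<le> 1"
        and eq: "\<And>z. z \<in> ball 0 1 \<Longrightarrow> g z = (0 - z) / (1 - cnj 0 * z) * h z"
        by (rule divide_out_zero[of g 0]) (use g g0 in \<open>auto simp: P_def\<close>)
      \<comment> \<open>For the zero 0 the factor divided out is -z, so the sign goes to the
        quotient.\<close>
      have "P (Suc m) (\<lambda>z. - h z)"
        using g h eq by (auto simp: P_def intro!: holomorphic_intros)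
      thus ?case by blast
    qed
    have "cmod (f w) \<le> 0"
    proof (rule tendsto_lowerbound)
      show "(\<lambda>m. cmod w ^ m) \<longlonglongrightarrow> 0"
        using w by (intro LIMSEQ_realpow_zero) auto
      show "\<forall>\<^sub>F m in sequentially. cmod (f w) \<le> cmod w ^ m"
      proof (intro always_eventually allI)
        fix m
        obtain g where "P m g" using ex by blast
        thus "cmod (f w) \<le> cmod w ^ m"
          using w by (auto simp: P_def norm_mult norm_power mult_left_le)
      qed
    qed simp
    with w show False by simp
  qed
  thus thesis
    using that unfolding P_def by blast
qed

section \<open>The lower bound from weak Property B, and the conclusion\<close>

lemma cmod_ge_on_sublevel_components:
  assumes B: "B holomorphic_on ball 0 1" and S: "S holomorphic_on ball 0 1"
    and nz: "\<And>z. z \<in> ball 0 1 \<Longrightarrow> S z \<noteq> 0"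
    and BS: "\<And>z. z \<in> ball 0 1 \<Longrightarrow> cmod (B z) \<le> cmod (S z)"
    and \<theta>: "0 < \<theta>"
    and comp: "\<And>C. C \<in> components {z \<in> ball 0 1. cmod (B z) < \<theta>} \<Longrightarrow> closure C \<subseteq> ball 0 1"
    and z: "z \<in> ball 0 1"
  shows "\<theta> \<le> cmod (S z)"
proof (cases "cmod (B z) < \<theta>")
  case False
  with BS[OF z] show ?thesis by simp
next
  case True
  let ?\<Omega> = "{z \<in> ball 0 1. cmod (B z) < \<theta>}"
  have "open (ball 0 1 \<inter> (\<lambda>z. cmod (B z)) -` {..<\<theta>})"
    by (intro continuous_open_preimage continuous_intros holomorphic_on_imp_continuous_on[OF B]) auto
  also have "ball 0 1 \<inter> (\<lambda>z. cmod (B z)) -` {..<\<theta>} = ?\<Omega>"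
    by auto
  finally have o\<Omega>: "open ?\<Omega>" .
  obtain C where C: "C \<in> components ?\<Omega>" "z \<in> C"
    using True z Union_components[of ?\<Omega>] by blast
  have oC: "open C"
    using open_components[OF o\<Omega> C(1)] .
  note clC = comp[OF C(1)]
  have subC: "C \<subseteq> ball 0 1"
    using clC closure_subset by blast
  \<comment> \<open>The closure of \<open>C\<close> lies in the disc, so a frontier point with a
    smaller value would belong to some component. That component is open and meets \<open>C\<close>,
    hence equals \<open>C\<close>; but the open set \<open>C\<close> contains none of its frontier
    points.\<close>
  have fr: "\<theta> \<le> cmod (B w)" if w: "w \<in> frontier C" for w
  proof (rule ccontr)
    assume "\<not> ?thesis"
    moreover have wC: "w \<in> closure C" "w \<notin> C"
      using w oC by (auto simp: frontier_def interior_open)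
    ultimately have "w \<in> ?\<Omega>"
      using clC by auto
    then obtain C' where C': "C' \<in> components ?\<Omega>" "w \<in> C'"
      using Union_components[of ?\<Omega>] by blast
    have "open C'"
      using open_components[OF o\<Omega> C'(1)] .
    hence "C' \<inter> C \<noteq> {}"
      using wC C'(2) open_Int_closure_eq_empty[of C' C] by blast
    hence "C' = C"
      using components_eq[OF C'(1) C(1)] by blast
    with wC C' show False by blast
  qed
  have "norm (1 / S z) \<le> 1 / \<theta>"
  proof (rule maximum_modulus_frontier[of "\<lambda>z. 1 / S z" C])
    have hol: "(\<lambda>z. 1 / S z) holomorphic_on ball 0 1"
      using nz by (intro holomorphic_intros S)
    show "(\<lambda>z. 1 / S z) holomorphic_on interior C"
      using hol by (rule holomorphic_on_subset) (use subC interior_subset in blast)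
    show "continuous_on (closure C) (\<lambda>z. 1 / S z)"
      using holomorphic_on_imp_continuous_on[OF hol] clC by (rule continuous_on_subset)
    show "bounded C"
      using subC bounded_ball bounded_subset by blast
    show "norm (1 / S w) \<le> 1 / \<theta>" if w: "w \<in> frontier C" for w
    proof -
      have "w \<in> ball 0 1"
        using w clC by (auto simp: frontier_def)
      with fr[OF w] BS[of w] have "\<theta> \<le> cmod (S w)" by simp
      thus ?thesis
        using \<theta> by (simp add: norm_divide frac_le)
    qed
  qed (fact C(2))
  thus ?thesis
    using \<theta> nz[OF z] by (simp add: norm_divide field_simps)
qed

theorem lemma4p1:
  fixes B :: "complex \<Rightarrow> complex"
  assumes "inner_function B"
    and "weak_property_B B"
  shows "blaschke_product B"
proof -
  from assms(1) have holB: "B holomorphic_on ball 0 1"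
    by (simp add: inner_function_def analytic_imp_holomorphic)
  from assms(1) have lim: "AE t in lebesgue_on {0..2 * pi}.
        ((\<lambda>r. cmod (B (complex_of_real r * cis t))) \<longlongrightarrow> 1) (at_left 1)"
    unfolding inner_function_def by (elim conjE AE_mp) (intro AE_I2, auto dest: tendsto_norm)
  from assms(1) obtain M where "\<And>z. z \<in> ball 0 1 \<Longrightarrow> cmod (B z) \<le> M"
    unfolding inner_function_def bounded_iff by blast
  \<comment> \<open>Inner functions are defined with an unspecified bound; the radial limits improve
    it to 1.\<close>
  from cmod_le_1_if_radial_limits_1[OF holB this lim]
  have B_le: "cmod (B z) \<le> 1" if "z \<in> ball 0 1" for z
    using that by blast
  have left: "\<forall>\<^sub>F r::real in at_left 1. complex_of_real r * cis t \<in> ball 0 1" for t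
    using eventually_at_left_real[of 0 1] by (auto elim!: eventually_mono simp: norm_mult)
  \<comment> \<open>If \<open>B\<close> vanished identically, its radial limits would be 0
    everywhere and of modulus 1 almost everywhere, making [0, 2 pi] a null set.\<close>
  have "\<exists>w\<in>ball 0 1. B w \<noteq> 0"
  proof (rule ccontr)
    assume "\<not> ?thesis"
    hence "B w = 0" if "w \<in> ball 0 1" for w
      using that by blast
    hence "((\<lambda>r. cmod (B (complex_of_real r * cis t))) \<longlongrightarrow> 0) (at_left 1)" for t
      by (intro tendsto_eventually eventually_mono[OF left]) simp
    hence "AE t in lebesgue_on {0..2 * pi}. False"
      using lim by (elim AE_mp) (intro AE_I2, metis tendsto_unique trivial_limit_at_left_real zero_neq_one)
    hence "emeasure (lebesgue_on {0..2 * pi}) (space (lebesgue_on {0..2 * pi})) = 0"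
      by (subst (asm) AE_iff_measurable[OF sets.top]) auto
    thus False
      by (simp add: emeasure_restrict_space)
  qed
  then obtain w where "w \<in> ball 0 1" "B w \<noteq> 0" by blast
  then obtain m g where holg: "g holomorphic_on ball 0 1"
    and g_le: "\<And>z. z \<in> ball 0 1 \<Longrightarrow> cmod (g z) \<le> 1" and g0: "g 0 \<noteq> 0"
    and Bg: "\<And>z. z \<in> ball 0 1 \<Longrightarrow> B z = z ^ m * g z"
    using factor_out_power[OF holB B_le] by metis
  obtain N a S where a: "\<And>n. enat n < N \<Longrightarrow> a n \<in> ball 0 1 - {0}"
    and summ: "summable (\<lambda>n. if enat n < N then 1 - cmod (a n) else 0)"
    and S: "S holomorphic_on ball 0 1" "\<And>z. z \<in> ball 0 1 \<Longrightarrow> S z \<noteq> 0"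
    and S_ge: "\<And>z. z \<in> ball 0 1 \<Longrightarrow> cmod (g z) \<le> cmod (S z)"
    and S_le: "\<And>z. z \<in> ball 0 1 \<Longrightarrow> cmod (S z) \<le> 1"
    and prod: "\<And>z. z \<in> ball 0 1 \<Longrightarrow>
           \<exists>p. (\<lambda>n. if enat n < N then blaschke_factor (a n) z else 1) has_prod p \<and> g z = p * S z"
  proof (rule split_off_blaschke_product[OF holg g_le g0], goal_cases)
    case (2 N a S)
    from 2(2-) show ?case by (rule 2(1))
  qed
  have BS: "cmod (B z) \<le> cmod (S z)" if z: "z \<in> ball 0 1" for z
  proof -
    have "cmod (B z) \<le> cmod (g z)"
      using z by (simp add: Bg[OF z] norm_mult norm_power mult_left_le_one_le power_le_one)
    with S_ge[OF z] show ?thesis by simp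
  qed
  obtain \<theta> where \<theta>: "0 < \<theta>"
    and comp: "\<And>C. C \<in> components {z \<in> ball 0 1. cmod (B z) < \<theta>} \<Longrightarrow> closure C \<subseteq> ball 0 1"
    using assms(2) by (auto simp: weak_property_B_def)
  have S_ge_\<theta>: "\<theta> \<le> cmod (S z)" if "z \<in> ball 0 1" for z
    by (rule cmod_ge_on_sublevel_components[OF holB S BS \<theta> comp that])
  \<comment> \<open>A nonconstant singular inner function is also zero-free with unimodular radial
    limits; the bound 1/\<theta> on the reciprocal is what rules it out.\<close>
  have inv_le: "cmod (1 / S z) \<le> 1" if z: "z \<in> ball 0 1" for z
  proof (rule cmod_le_1_if_radial_limits_1[where f = "\<lambda>z. 1 / S z"])
    show "(\<lambda>z. 1 / S z) holomorphic_on ball 0 1"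
      using S(2) by (intro holomorphic_intros S(1))
    show "cmod (1 / S z) \<le> 1 / \<theta>" if "z \<in> ball 0 1" for z
      using S_ge_\<theta>[OF that] \<theta> by (simp add: norm_divide frac_le)
    show "AE t in lebesgue_on {0..2 * pi}.
        ((\<lambda>r. cmod (1 / S (complex_of_real r * cis t))) \<longlongrightarrow> 1) (at_left 1)"
      using lim
    proof eventually_elim
      case (elim t)
      have "((\<lambda>r. cmod (S (complex_of_real r * cis t))) \<longlongrightarrow> 1) (at_left 1)"
      proof (rule tendsto_sandwich[OF _ _ elim tendsto_const])
        show "\<forall>\<^sub>F r in at_left 1. cmod (B (complex_of_real r * cis t)) \<le> cmod (S (complex_of_real r * cis t))"
          using left by eventually_elim (rule BS)
        show "\<forall>\<^sub>F r in at_left 1. cmod (S (complex_of_real r * cis t)) \<le> 1"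
          using left by eventually_elim (rule S_le)
      qed
      from tendsto_divide[OF tendsto_const[of 1] this] show ?case
        by (simp add: norm_divide)
    qed
  qed (fact z)
  have S1: "cmod (S z) = 1" if z: "z \<in> ball 0 1" for z
    using inv_le[OF z] S_le[OF z] S(2)[OF z] by (simp add: norm_divide field_simps)
  \<comment> \<open>As |S| is constantly 1, it attains its maximum at the interior point 0.\<close>
  have "S constant_on ball 0 1"
    by (rule maximum_modulus_principle[OF S(1), where U = "ball 0 1" and \<xi> = 0]) (use S1 in auto)
  then obtain c where c: "\<And>z. z \<in> ball 0 1 \<Longrightarrow> S z = c"
    by (auto simp: constant_on_def)
  have "cmod c = 1"
    using S1[of 0] c[of 0] by simp
  moreover have "\<exists>p. (\<lambda>n. if enat n < N then blaschke_factor (a n) z else 1) has_prod p \<and>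
          B z = c * z ^ m * p" if z: "z \<in> ball 0 1" for z
    using prod[OF z] Bg[OF z] c[OF z] by (auto simp: mult_ac)
  ultimately show ?thesis
    using assms(1) a summ unfolding blaschke_product_def by blast
qed

end
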